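(* Let $K\neq\Delta^{m-1}$ be a finite simplicial complex with $m$ vertices and no ghost vertices. Then $$\mathrm{DH}_{-k,2l}(\mathcal{Z}_K)\cong \overline{E}^2_{m-l-1,\,l-k-1}(K)$$ for all $k,l\in\mathbb{N}$, where $\overline{E}^2(K)$ is the second page of the reduced augmented Mayer–Vietoris spectral sequence of $K$ with respect to the anti-star cover.
   Context: All homology has coefficients in $\mathbb{Z}$. $V=V(K)=\{v_1,\dots,v_m\}$ is the vertex set of $K$; no ghost vertices means $K[I]=\emptyset$ if and only if $I=\emptyset$, where for $I\subseteq V$, $K[I]$ is the subcomplex of simplices with all vertices in $I$. $\Delta^{m-1}$ is the full simplex on the $m$ vertices. $\widetilde{\mathrm{H}}_*$ is reduced simplicial homology, with $\widetilde{\mathrm{H}}_p(\emptyset)=\mathbb{Z}$ if $p=-1$ and $0$ otherwise. Identify $v_i$ with its index $i$ when comparing vertices. **Double homology.** The homology of the moment-angle complex $\mathcal{Z}_K$ decomposes as $\mathrm{H}_p(\mathcal{Z}_K)\cong\bigoplus_{2l-k=p}\mathrm{H}_{-k,2l}(\mathcal{Z}_K)$ with $\mathrm{H}_{-k,2l}(\mathcal{Z}_K)=\bigoplus_{|I|=l}\widetilde{\mathrm{H}}_{l-k-1}(K[I])$. Let $\phi_{p,I,j}\colon\widetilde{\mathrm{H}}_p(K[I])\to\widetilde{\mathrm{H}}_p(K[I\cup\{j\}])$ be induced by inclusion. The differential $\partial'_{-k,2l}\colon\mathrm{H}_{-k,2l}(\mathcal{Z}_K)\to\mathrm{H}_{-k-1,2l+2}(\mathcal{Z}_K)$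 is given on the summand of $I$, with $p=l-k-1$, by $\partial'_p=(-1)^{p+1}\sum_{j\in V\setminus I}(-1)^{|\{i\in I:\, i<j\}|}\phi_{p,I,j}$. $\mathrm{DH}_{-k,2l}(\mathcal{Z}_K)$ is the homology of $(\mathrm{H}_{*,*}(\mathcal{Z}_K),\partial')$ in bidegree $(-k,2l)$. **Spectral sequence.** The anti-star of $v\in V$ is $\mathrm{ast}_K(v)=K[V\setminus\{v\}]$, and the anti-star cover is $\mathcal{U}^{\mathrm{ast}}=\{\mathrm{ast}_K(v)\}_{v\in V}$. To $S=\{v_{j_0},\dots,v_{j_p}\}\subseteq V$ (with $j_0<\dots<j_p$) associate $U_S=\mathrm{ast}_K(v_{j_0})\cap\dots\cap\mathrm{ast}_K(v_{j_p})=K[V\setminus S]$, with $U_\emptyset=K$ and $U_V=\emptyset$. The reduced augmented Mayer–Vietoris spectral sequence of $K$ with respect to $\mathcal{U}^{\mathrm{ast}}$ is the one obtained from the double complex $$C^0_{p,q}=\bigoplus_{S\subseteq V,\ |S|=p+1}\widetilde{C}_q(U_S),\qquad -1\le p\le m-1,\ q\ge -1,$$ where $\widetilde{C}_*$ is the augmented simplicial chain complex ($\widetilde{C}_{-1}=\mathbb{Z}$, also for the empty complex), the vertical differential $C^0_{p,q}\to C^0_{p,q-1}$ is the (augmented) simplicial differential, and the horizontal differential $\delta_h\colon C^0_{p,q}\to C^0_{p-1,q}$ is, on the summand of $S$, $\sum_t(-1)^t$ times the inclusion-induced map to the summand of $S\setminus\{v_{j_t}\}$; vertical homology is taken first. Thus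 its first page is $\overline{E}^1_{p,q}=\bigoplus_{|S|=p+1}\widetilde{\mathrm{H}}_q(K[V\setminus S])$ (so $\overline{E}^1_{-1,q}=\widetilde{\mathrm{H}}_q(K)$, and the only non-zero term in row $q=-1$ is $\overline{E}^1_{m-1,-1}=\mathbb{Z}$), with differential $\overline{E}^1_{p,q}\to\overline{E}^1_{p-1,q}$ induced by $\delta_h$, and $\overline{E}^2$ is the homology of $\overline{E}^1$. *)

theory Defs
  imports "HOL-Algebra.Free_Abelian_Groups"
begin

subsection \<open>Homology of a composable pair of homomorphisms\<close>

text \<open>Homology at \<open>B\<close> of \<open>A \<rightarrow> B \<rightarrow> C\<close> (maps \<open>f\<close> and \<open>g\<close>): the kernel of \<open>g\<close> modulo the image of
  \<open>f\<close>, so an element is a coset of \<open>f ` carrier A\<close>.\<close>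

definition homology_at ::
  "'a monoid \<Rightarrow> ('a \<Rightarrow> 'b) \<Rightarrow> 'b monoid \<Rightarrow> ('b \<Rightarrow> 'c) \<Rightarrow> 'c monoid \<Rightarrow> 'b set monoid"
  where "homology_at A f B g C = subgroup_generated B (kernel B C g) Mod (f ` carrier A)"

text \<open>The map of classes induced by a map of cycles \<open>h\<close>, where \<open>N\<close> is the group of boundaries of the
  target \<open>B\<close>. When \<open>h\<close> respects boundaries, all cosets in the union coincide, so the union is
  the class of \<open>h z\<close> for any representative \<open>z\<close> of \<open>c\<close>.\<close>

definition induced_on_classes :: "'b monoid \<Rightarrow> 'b set \<Rightarrow> ('a \<Rightarrow> 'b) \<Rightarrow> 'a set \<Rightarrow> 'b set"
  where "induced_on_classes B N h c = (\<Union>z\<in>c. N #>\<^bsub>B\<^esub> h z)"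

subsection \<open>Simplicial complexes and reduced homology\<close>

text \<open>The empty simplex always belongs to a complex; the empty complex is \<open>{{}}\<close>, and the full
  simplex on \<open>V\<close> is \<open>Pow V\<close>. A vertex of the ambient set \<open>V\<close> need not be a simplex of \<open>K\<close>.\<close>

definition simplicial_complex :: "'v set \<Rightarrow> 'v set set \<Rightarrow> bool"
  where "simplicial_complex V K \<longleftrightarrow>
    finite V \<and> {} \<in> K \<and> (\<forall>\<sigma>\<in>K. \<sigma> \<subseteq> V) \<and> (\<forall>\<sigma>\<in>K. \<forall>\<tau>. \<tau> \<subseteq> \<sigma> \<longrightarrow> \<tau> \<in> K)"

definition full_subcomplex :: "'v set set \<Rightarrow> 'v set \<Rightarrow> 'v set set"
  where "full_subcomplex K I = {\<sigma> \<in> K. \<sigma> \<subseteq> I}"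

definition no_ghost_vertices :: "'v set \<Rightarrow> 'v set set \<Rightarrow> bool"
  where "no_ghost_vertices V K \<longleftrightarrow> (\<forall>I\<subseteq>V. full_subcomplex K I = {{}} \<longleftrightarrow> I = {})"

text \<open>Augmented simplicial chains, in all integer degrees: degree \<open>-1\<close> is generated by the empty
  simplex, and the group is trivial in degrees below \<open>-1\<close>.\<close>

definition chain_group :: "'v set set \<Rightarrow> int \<Rightarrow> ('v set \<Rightarrow>\<^sub>0 int) monoid"
  where "chain_group K q = free_Abelian_group {\<sigma> \<in> K. int (card \<sigma>) = q + 1}"

text \<open>A simplex is oriented by the order of its vertices: the exponent is the position \<open>t\<close> of \<open>w = w\<^sub>t\<close>
  in \<open>\<sigma> = {w\<^sub>0 < \<dots> < w\<^sub>q}\<close>. On vertices this is the augmentation.\<close>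

definition boundary :: "('v::linorder set \<Rightarrow>\<^sub>0 int) \<Rightarrow> ('v set \<Rightarrow>\<^sub>0 int)"
  where "boundary =
    frag_extend (\<lambda>\<sigma>. \<Sum>w\<in>\<sigma>. frag_cmul ((-1) ^ card {u \<in> \<sigma>. u < w}) (frag_of (\<sigma> - {w})))"

definition reduced_homology :: "int \<Rightarrow> 'v::linorder set set \<Rightarrow> ('v set \<Rightarrow>\<^sub>0 int) set monoid"
  where "reduced_homology q K =
    homology_at (chain_group K (q + 1)) boundary (chain_group K q) boundary (chain_group K (q - 1))"

text \<open>The map \<open>reduced_homology q L \<rightarrow> reduced_homology q K\<close> induced by an inclusion \<open>L \<subseteq> K\<close>; on chains
  the inclusion is the identity.\<close>

definition inclusion_induced ::
  "int \<Rightarrow> 'v::linorder set set \<Rightarrow> ('v set \<Rightarrow>\<^sub>0 int) set \<Rightarrow> ('v set \<Rightarrow>\<^sub>0 int) set"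
  where "inclusion_induced q K =
    induced_on_classes (chain_group K q) (boundary ` carrier (chain_group K (q + 1))) id"

definition subsets_of_size :: "'v set \<Rightarrow> int \<Rightarrow> 'v set set"
  where "subsets_of_size V n = {S. S \<subseteq> V \<and> int (card S) = n}"

subsection \<open>Double homology\<close>

text \<open>\<open>mac_homology V K k l\<close> is the bigraded piece \<open>H\<^sub>-\<^sub>k\<^sub>,\<^sub>2\<^sub>l\<close> of the homology of the moment-angle complex;
  \<open>k\<close> and \<open>l\<close> are integers so that neighbouring bidegrees need no case distinction.\<close>

definition mac_homology ::
  "'v::linorder set \<Rightarrow> 'v set set \<Rightarrow> int \<Rightarrow> int \<Rightarrow> ('v set \<Rightarrow> ('v set \<Rightarrow>\<^sub>0 int) set) monoid"
  where "mac_homology V K k l =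
    sum_group (subsets_of_size V l) (\<lambda>I. reduced_homology (l - k - 1) (full_subcomplex K I))"

text \<open>The differential from bidegree \<open>(-k, 2l)\<close> to bidegree \<open>(-k-1, 2l+2)\<close>, by components: the summand
  of \<open>J\<close> receives one term from each \<open>I = J - {j}\<close>. The groups are written multiplicatively, so
  sums are products and the sign is an integer exponent. The absolute value only serves to
  make \<open>(-1)\<^sup>p\<^sup>+\<^sup>1\<close> meaningful for negative exponents.\<close>

definition mac_differential ::
  "'v::linorder set \<Rightarrow> 'v set set \<Rightarrow> int \<Rightarrow> int
    \<Rightarrow> ('v set \<Rightarrow> ('v set \<Rightarrow>\<^sub>0 int) set) \<Rightarrow> ('v set \<Rightarrow> ('v set \<Rightarrow>\<^sub>0 int) set)"
  where "mac_differential V K k l x =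
    (let p = l - k - 1 in
     (\<lambda>J\<in>subsets_of_size V (l + 1).
       let G = reduced_homology p (full_subcomplex K J) in
       finprod G
         (\<lambda>j. let I = J - {j} in
            inclusion_induced p (full_subcomplex K J) (x I)
              [^]\<^bsub>G\<^esub> ((-1) ^ nat \<bar>p + 1\<bar> * (-1) ^ card {i \<in> I. i < j} :: int))
         J))"

text \<open>\<open>double_homology V K k l\<close> is \<open>DH\<^sub>-\<^sub>k\<^sub>,\<^sub>2\<^sub>l\<close>.\<close>

definition double_homology ::
  "'v::linorder set \<Rightarrow> 'v set set \<Rightarrow> int \<Rightarrow> int \<Rightarrow> ('v set \<Rightarrow> ('v set \<Rightarrow>\<^sub>0 int) set) set monoid"
  where "double_homology V K k l =
    homology_at
      (mac_homology V K (k - 1) (l - 1)) (mac_differential V K (k - 1) (l - 1))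
      (mac_homology V K k l) (mac_differential V K k l)
      (mac_homology V K (k + 1) (l + 1))"

subsection \<open>The reduced augmented Mayer--Vietoris spectral sequence\<close>

text \<open>A cover of \<open>K\<close> is a family \<open>U\<close> of subcomplexes indexed by a finite linearly ordered set \<open>V\<close>.
  The intersection with \<open>K\<close> makes the empty intersection equal to \<open>K\<close>.\<close>

definition cover_intersection :: "'v set set \<Rightarrow> ('v \<Rightarrow> 'v set set) \<Rightarrow> 'v set \<Rightarrow> 'v set set"
  where "cover_intersection K U S = K \<inter> (\<Inter>v\<in>S. U v)"

definition mv_complex ::
  "'v set \<Rightarrow> 'v set set \<Rightarrow> ('v \<Rightarrow> 'v set set) \<Rightarrow> int \<Rightarrow> int \<Rightarrow> ('v set \<Rightarrow> ('v set \<Rightarrow>\<^sub>0 int)) monoid"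
  where "mv_complex V K U p q =
    sum_group (subsets_of_size V (p + 1)) (\<lambda>S. chain_group (cover_intersection K U S) q)"

definition mv_vertical ::
  "'v::linorder set \<Rightarrow> int \<Rightarrow> ('v set \<Rightarrow> ('v set \<Rightarrow>\<^sub>0 int)) \<Rightarrow> ('v set \<Rightarrow> ('v set \<Rightarrow>\<^sub>0 int))"
  where "mv_vertical V p x = (\<lambda>S\<in>subsets_of_size V (p + 1). boundary (x S))"

text \<open>The horizontal differential from column \<open>p\<close> to column \<open>p - 1\<close>, by components: the summand of \<open>T\<close>
  receives one term from each \<open>S = T \<union> {v}\<close> with \<open>v \<notin> T\<close>, and the exponent is the position of \<open>v\<close> in \<open>S\<close>.
  The inclusion-induced chain maps are identities.\<close>

definition mv_horizontal ::
  "'v::linorder set \<Rightarrow> int \<Rightarrow> ('v set \<Rightarrow> ('v set \<Rightarrow>\<^sub>0 int)) \<Rightarrow> ('v set \<Rightarrow> ('v set \<Rightarrow>\<^sub>0 int))"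
  where "mv_horizontal V p x =
    (\<lambda>T\<in>subsets_of_size V p.
       \<Sum>v\<in>V - T. let S = insert v T in frag_cmul ((-1) ^ card {u \<in> S. u < v}) (x S))"

definition mv_page1 ::
  "'v::linorder set \<Rightarrow> 'v set set \<Rightarrow> ('v \<Rightarrow> 'v set set) \<Rightarrow> int \<Rightarrow> int
    \<Rightarrow> ('v set \<Rightarrow> ('v set \<Rightarrow>\<^sub>0 int)) set monoid"
  where "mv_page1 V K U p q =
    homology_at
      (mv_complex V K U p (q + 1)) (mv_vertical V p)
      (mv_complex V K U p q) (mv_vertical V p)
      (mv_complex V K U p (q - 1))"

definition mv_differential1 ::
  "'v::linorder set \<Rightarrow> 'v set set \<Rightarrow> ('v \<Rightarrow> 'v set set) \<Rightarrow> int \<Rightarrow> int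
    \<Rightarrow> ('v set \<Rightarrow> ('v set \<Rightarrow>\<^sub>0 int)) set \<Rightarrow> ('v set \<Rightarrow> ('v set \<Rightarrow>\<^sub>0 int)) set"
  where "mv_differential1 V K U p q =
    induced_on_classes
      (mv_complex V K U (p - 1) q)
      (mv_vertical V (p - 1) ` carrier (mv_complex V K U (p - 1) (q + 1)))
      (mv_horizontal V p)"

definition mv_page2 ::
  "'v::linorder set \<Rightarrow> 'v set set \<Rightarrow> ('v \<Rightarrow> 'v set set) \<Rightarrow> int \<Rightarrow> int
    \<Rightarrow> ('v set \<Rightarrow> ('v set \<Rightarrow>\<^sub>0 int)) set set monoid"
  where "mv_page2 V K U p q =
    homology_at
      (mv_page1 V K U (p + 1) q) (mv_differential1 V K U (p + 1) q)
      (mv_page1 V K U p q) (mv_differential1 V K U p q)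
      (mv_page1 V K U (p - 1) q)"

definition anti_star :: "'v set \<Rightarrow> 'v set set \<Rightarrow> 'v \<Rightarrow> 'v set set"
  where "anti_star V K v = full_subcomplex K (V - {v})"

end

theory Submission
  imports Defs
begin

text \<open>Sending the summand of \<open>S\<close> to the summand of \<open>I = V - S\<close> identifies the first page with the homology of
  the moment-angle complex, since \<open>U\<^sub>S = K[V - S]\<close> and homology commutes with finite direct sums. Removing a
  vertex from \<open>S\<close> is adding it to \<open>I\<close>, so the two differentials agree up to signs; multiplying the
  summand of \<open>S\<close> by a suitable product of signs over \<open>s \<in> S\<close> makes them equal.\<close>

section \<open>Homology of a composable pair\<close>

text \<open>All bidegrees involved have the same \<open>q = l - k - 1\<close>, because the
  differential raises \<open>k\<close> and \<open>l\<close> together; so three neighbouring columns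
  of a single row are compared. The obstacle is the form of the elements: a class on the first page
  is one coset, that is a set of families of chains, while an element of \<open>mac_homology\<close>
  is a family of cosets. By \<open>coset_sum_group\<close> the coset is the full product of its
  components, so projecting it recovers them without choosing representatives. The sign
  \<open>(-1)^(q+1)\<close> shared by all terms of the double homology differential can be spread
  over the elements of \<open>S\<close>, one factor each, because every application removes exactly
  one element from \<open>S\<close>. Sizes and degrees are integers: beyond the ends
  \<open>subsets_of_size\<close> is empty and the groups on both sides are trivial together, so the
  ends are covered by the same argument.\<close>

lemma generate_image_iso:
  assumes "group B" "group B'" and h: "h \<in> iso B B'" and "S \<subseteq> carrier B"
  shows "generate B' (h ` S) = h ` generate B S"
proof -
  interpret group_hom B B' h
    using assms by (simp add: group_hom_def group_hom_axioms_def iso_def)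
  show ?thesis
    using assms(4) by (rule generate_img)
qed

text \<open>Taking images under \<open>\<beta>\<close> sends cosets of boundaries to cosets of
  boundaries. Only the sets of cycles and of boundaries must correspond, which is why
  \<open>\<alpha>\<close> is described by its image and \<open>\<gamma>\<close> by injectivity and
  its value at the unit. With \<open>f\<close> and \<open>g\<close> mere functions, the cycles are
  the subgroup generated by the kernel, so \<open>generate\<close> is carried through.\<close>

lemma homology_at_iso:
  assumes grp: "group B" "group B'"
    and \<beta>: "\<beta> \<in> iso B B'"
    and \<alpha>: "\<alpha> ` carrier A = carrier A'"
    and \<gamma>: "inj_on \<gamma> (carrier C)" "\<gamma> \<one>\<^bsub>C\<^esub> = \<one>\<^bsub>C'\<^esub>" "\<one>\<^bsub>C\<^esub> \<in> carrier C"
    and f: "f \<in> carrier A \<rightarrow> carrier B" and g: "g \<in> carrier B \<rightarrow> carrier C"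
    and \<beta>f: "\<And>a. a \<in> carrier A \<Longrightarrow> \<beta> (f a) = f' (\<alpha> a)"
    and \<gamma>g: "\<And>b. b \<in> carrier B \<Longrightarrow> \<gamma> (g b) = g' (\<beta> b)"
  shows "homology_at A f B g C \<cong> homology_at A' f' B' g' C'"
proof -
  let ?H = "homology_at A f B g C" and ?H' = "homology_at A' f' B' g' C'"
  let ?Z = "generate B (kernel B C g)" and ?N = "f ` carrier A"
  let ?Z' = "generate B' (kernel B' C' g')" and ?N' = "f' ` carrier A'"
  have inj: "inj_on \<beta> (carrier B)" and img: "\<beta> ` carrier B = carrier B'"
    and hom: "\<And>x y. x \<in> carrier B \<Longrightarrow> y \<in> carrier B \<Longrightarrow> \<beta> (x \<otimes>\<^bsub>B\<^esub> y) = \<beta> x \<otimes>\<^bsub>B'\<^esub> \<beta> y"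
    using \<beta> by (auto simp: iso_def bij_betw_def hom_def)
  have "\<beta> ` kernel B C g = kernel B' C' g'"
  proof -
    have "g b = \<one>\<^bsub>C\<^esub> \<longleftrightarrow> g' (\<beta> b) = \<one>\<^bsub>C'\<^esub>" if "b \<in> carrier B" for b
      using that \<gamma> \<gamma>g g by (metis PiE inj_on_eq_iff)
    then show ?thesis
      unfolding kernel_def img[symmetric] by auto
  qed
  then have Z: "\<beta> ` ?Z = ?Z'"
    using generate_image_iso[OF grp \<beta>, of "kernel B C g"] by (auto simp: kernel_def)
  have Zsub: "?Z \<subseteq> carrier B"
    using group.generate_incl[OF grp(1), of "kernel B C g"] by (auto simp: kernel_def)
  have Nsub: "?N \<subseteq> carrier B"
    using f by auto
  have N: "\<beta> ` ?N = ?N'"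
    unfolding \<alpha>[symmetric] image_image using \<beta>f by (rule image_cong[OF refl])
  have carr: "carrier ?H = (\<lambda>z. ?N #>\<^bsub>B\<^esub> z) ` ?Z" "carrier ?H' = (\<lambda>z. ?N' #>\<^bsub>B'\<^esub> z) ` ?Z'"
    by (simp_all add: homology_at_def carrier_FactGroup carrier_subgroup_generated r_coset_def
        Int_absorb1 kernel_def)
  have coset: "\<beta> ` (?N #>\<^bsub>B\<^esub> z) = ?N' #>\<^bsub>B'\<^esub> \<beta> z" if "z \<in> carrier B" for z
  proof -
    have "\<beta> ` (?N #>\<^bsub>B\<^esub> z) = (\<lambda>n. \<beta> (n \<otimes>\<^bsub>B\<^esub> z)) ` ?N"
      by (auto simp: r_coset_def)
    also have "\<dots> = (\<lambda>n. \<beta> n \<otimes>\<^bsub>B'\<^esub> \<beta> z) ` ?N"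
      using that Nsub hom by (intro image_cong) auto
    also have "\<dots> = ?N' #>\<^bsub>B'\<^esub> \<beta> z"
      by (auto simp: r_coset_def simp flip: N)
    finally show ?thesis .
  qed
  have sub: "X \<subseteq> carrier B" if "X \<in> carrier ?H" for X
    using that Zsub monoid.r_coset_subset_G[OF group.is_monoid[OF grp(1)] Nsub]
    unfolding carr by blast
  have "image \<beta> \<in> iso ?H ?H'"
  proof (rule isoI)
    show "image \<beta> \<in> hom ?H ?H'"
    proof (rule homI)
      show "\<beta> ` X \<in> carrier ?H'" if "X \<in> carrier ?H" for X
      proof -
        from that obtain z where z: "z \<in> ?Z" "X = ?N #>\<^bsub>B\<^esub> z"
          unfolding carr by blast
        then have "\<beta> ` X = ?N' #>\<^bsub>B'\<^esub> \<beta> z" "\<beta> z \<in> ?Z'"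
          using coset Zsub by (auto simp flip: Z)
        then show ?thesis
          unfolding carr by blast
      qed
      show "\<beta> ` (X \<otimes>\<^bsub>?H\<^esub> Y) = \<beta> ` X \<otimes>\<^bsub>?H'\<^esub> \<beta> ` Y"
        if "X \<in> carrier ?H" "Y \<in> carrier ?H" for X Y
      proof -
        have "\<beta> ` (\<Union>x\<in>X. \<Union>y\<in>Y. {x \<otimes>\<^bsub>B\<^esub> y}) = (\<Union>x\<in>X. \<Union>y\<in>Y. {\<beta> x \<otimes>\<^bsub>B'\<^esub> \<beta> y})"
          using hom sub[OF that(1)] sub[OF that(2)] unfolding image_UN image_insert image_empty
          by (intro SUP_cong refl) auto
        then show ?thesis
          by (simp add: homology_at_def set_mult_def)
      qed
    qed
    show "bij_betw (image \<beta>) (carrier ?H) (carrier ?H')"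
      unfolding bij_betw_def
    proof
      show "inj_on (image \<beta>) (carrier ?H)"
        using inj sub by (auto simp: inj_on_def inj_on_image_eq_iff)
      have "image \<beta> ` carrier ?H = (\<lambda>z. ?N' #>\<^bsub>B'\<^esub> \<beta> z) ` ?Z"
        using coset Zsub unfolding carr image_image by (intro image_cong) auto
      also have "\<dots> = carrier ?H'"
        by (simp add: carr image_image flip: Z)
      finally show "image \<beta> ` carrier ?H = carrier ?H'" .
    qed
  qed
  then show ?thesis
    by (auto simp: is_iso_def)
qed

text \<open>The given maps run from the unprimed to the primed sequence, the conclusion the other
  way. The inversion is made on the three terms, which are known to be groups; inverting the
  resulting isomorphism would first require the homology to be a group.\<close>

lemma homology_at_iso_converse:
  assumes grp: "group A" "group B" "group C" "group C'"
    and iso: "\<alpha> \<in> iso A A'" "\<beta> \<in> iso B B'" "\<gamma> \<in> iso C C'" and "group B'"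
    and f: "f \<in> carrier A \<rightarrow> carrier B" and g: "g \<in> carrier B \<rightarrow> carrier C"
    and \<beta>f: "\<And>a. a \<in> carrier A \<Longrightarrow> \<beta> (f a) = f' (\<alpha> a)"
    and \<gamma>g: "\<And>b. b \<in> carrier B \<Longrightarrow> \<gamma> (g b) = g' (\<beta> b)"
  shows "homology_at A' f' B' g' C' \<cong> homology_at A f B g C"
proof (rule homology_at_iso)
  let ?\<alpha> = "inv_into (carrier A) \<alpha>" and ?\<beta> = "inv_into (carrier B) \<beta>"
    and ?\<gamma> = "inv_into (carrier C) \<gamma>"
  have bij: "bij_betw \<alpha> (carrier A) (carrier A')" "bij_betw \<beta> (carrier B) (carrier B')"
    "bij_betw \<gamma> (carrier C) (carrier C')"
    using iso by (auto simp: iso_def)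
  note inv = bij_betw_inv_into_left[OF bij(1)] bij_betw_inv_into_left[OF bij(2)]
    bij_betw_inv_into_left[OF bij(3)]
  show "?\<beta> \<in> iso B' B"
    using group.iso_set_sym[OF grp(2) iso(2)] .
  show "?\<alpha> ` carrier A' = carrier A" "inj_on ?\<gamma> (carrier C')"
    using bij_betw_inv_into[OF bij(1)] bij_betw_inv_into[OF bij(3)] by (auto simp: bij_betw_def)
  have "\<gamma> \<one>\<^bsub>C\<^esub> = \<one>\<^bsub>C'\<^esub>"
    using iso(3) grp(3,4) by (auto simp: iso_def intro: hom_one)
  moreover have one: "\<one>\<^bsub>C\<^esub> \<in> carrier C"
    using grp(3) by (simp add: group.is_monoid)
  ultimately show "?\<gamma> \<one>\<^bsub>C'\<^esub> = \<one>\<^bsub>C\<^esub>"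
    using inv(3)[OF one] by simp
  show "\<one>\<^bsub>C'\<^esub> \<in> carrier C'"
    using grp(4) by (simp add: group.is_monoid)
  have A': "\<exists>a. a \<in> carrier A \<and> a' = \<alpha> a" if "a' \<in> carrier A'" for a'
    using that bij_betw_imp_surj_on[OF bij(1)] by blast
  have B': "\<exists>b. b \<in> carrier B \<and> b' = \<beta> b" if "b' \<in> carrier B'" for b'
    using that bij_betw_imp_surj_on[OF bij(2)] by blast
  show "?\<beta> (f' a') = f (?\<alpha> a')" if "a' \<in> carrier A'" for a'
  proof -
    obtain a where a: "a \<in> carrier A" "a' = \<alpha> a"
      using A' \<open>a' \<in> carrier A'\<close> by blast
    then show ?thesis
      using f inv(1)[of a] inv(2)[of "f a"] \<beta>f[of a] by auto
  qed
  show "?\<gamma> (g' b') = g (?\<beta> b')" if "b' \<in> carrier B'" for b'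
  proof -
    obtain b where b: "b \<in> carrier B" "b' = \<beta> b"
      using B' \<open>b' \<in> carrier B'\<close> by blast
    then show ?thesis
      using g inv(2)[of b] inv(3)[of "g b"] \<gamma>g[of b] by auto
  qed
  \<comment> \<open>On carriers \<open>f'\<close> is \<open>f\<close> conjugated by the
    isomorphisms, so its range is inherited from \<open>f\<close>; likewise \<open>g'\<close>
    below.\<close>
  show "f' \<in> carrier A' \<rightarrow> carrier B'"
  proof
    fix a' assume "a' \<in> carrier A'"
    then obtain a where a: "a \<in> carrier A" "a' = \<alpha> a"
      using A' by blast
    then have "f' a' = \<beta> (f a)" "f a \<in> carrier B"
      using \<beta>f f by auto
    then show "f' a' \<in> carrier B'"
      using bij_betwE[OF bij(2)] by auto
  qed
  show "g' \<in> carrier B' \<rightarrow> carrier C'"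
  proof
    fix b' assume "b' \<in> carrier B'"
    then obtain b where b: "b \<in> carrier B" "b' = \<beta> b"
      using B' by blast
    then have "g' b' = \<gamma> (g b)" "g b \<in> carrier C"
      using \<gamma>g g by auto
    then show "g' b' \<in> carrier C'"
      using bij_betwE[OF bij(3)] by auto
  qed
qed fact+

section \<open>Arithmetic of classes when the composite is trivial\<close>

locale homology_pair =
  fixes A :: "'a monoid" and f :: "'a \<Rightarrow> 'b" and B :: "'b monoid" and g :: "'b \<Rightarrow> 'c"
    and C :: "'c monoid"
  assumes grpA: "group A" and commB: "comm_group B" and grpC: "group C"
    and homf: "f \<in> hom A B" and homg: "g \<in> hom B C"
    and gf: "\<And>a. a \<in> carrier A \<Longrightarrow> g (f a) = \<one>\<^bsub>C\<^esub>"
begin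

lemma group_B: "group B"
  using commB comm_group_def by blast

lemma subgroup_kernel: "subgroup (kernel B C g) B"
  using grpC group_B homg by (simp add: group_hom.subgroup_kernel group_hom_axioms.intro group_hom_def)

lemma subgroup_image: "subgroup (f ` carrier A) B"
  using grpA group_B homf by (simp add: group_hom.img_is_subgroup group_hom_axioms.intro group_hom_def)

lemma image_subset_kernel: "f ` carrier A \<subseteq> kernel B C g"
  using gf homf by (auto simp: kernel_def hom_def)

lemma carrier_cycles: "carrier (subgroup_generated B (kernel B C g)) = kernel B C g"
  by (rule subgroup.carrier_subgroup_generated_subgroup[OF subgroup_kernel])

lemma comm_group_homology_at: "comm_group (homology_at A f B g C)"
proof -
  have "comm_group (subgroup_generated B (kernel B C g))"
    by (rule group.abelian_subgroup_generated[OF group_B commB])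
  moreover have "subgroup (f ` carrier A) (subgroup_generated B (kernel B C g))"
    using subgroup_image image_subset_kernel
    by (simp add: group.subgroup_subgroup_generated_iff[OF group_B] carrier_cycles)
  ultimately show ?thesis
    unfolding homology_at_def by (rule comm_group.abelian_FactGroup)
qed

lemma group_homology_at: "group (homology_at A f B g C)"
  using comm_group_homology_at comm_group_def by blast

lemma carrier_homology_at:
  "carrier (homology_at A f B g C) = (\<lambda>z. f ` carrier A #>\<^bsub>B\<^esub> z) ` kernel B C g"
  by (simp add: homology_at_def carrier_FactGroup carrier_cycles r_coset_def)

lemma mult_homology_at:
  assumes "z \<in> carrier B" "w \<in> carrier B"
  shows "(f ` carrier A #>\<^bsub>B\<^esub> z) \<otimes>\<^bsub>homology_at A f B g C\<^esub> (f ` carrier A #>\<^bsub>B\<^esub> w)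
    = f ` carrier A #>\<^bsub>B\<^esub> (z \<otimes>\<^bsub>B\<^esub> w)"
proof -
  have "f ` carrier A \<lhd> B"
    using comm_group.normal_iff_subgroup[OF commB] subgroup_image by blast
  from normal.rcos_sum[OF this assms] show ?thesis
    by (simp add: homology_at_def set_mult_def)
qed

lemma one_homology_at: "\<one>\<^bsub>homology_at A f B g C\<^esub> = f ` carrier A #>\<^bsub>B\<^esub> \<one>\<^bsub>B\<^esub>"
  using group.coset_join2[OF group_B _ subgroup_image, of "\<one>\<^bsub>B\<^esub>"] subgroup_image
  by (simp add: homology_at_def group_B group.is_monoid subgroup.one_closed)

lemma class_hom:
  "(\<lambda>z. f ` carrier A #>\<^bsub>B\<^esub> z) \<in> hom (subgroup_generated B (kernel B C g)) (homology_at A f B g C)"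
proof (rule homI)
  have "kernel B C g \<subseteq> carrier B"
    by (auto simp: kernel_def)
  then show "f ` carrier A #>\<^bsub>B\<^esub> (z \<otimes>\<^bsub>subgroup_generated B (kernel B C g)\<^esub> w)
      = (f ` carrier A #>\<^bsub>B\<^esub> z) \<otimes>\<^bsub>homology_at A f B g C\<^esub> (f ` carrier A #>\<^bsub>B\<^esub> w)"
    if "z \<in> carrier (subgroup_generated B (kernel B C g))"
      "w \<in> carrier (subgroup_generated B (kernel B C g))" for z w
    using that mult_homology_at[of z w] by (simp add: carrier_cycles subset_iff)
qed (auto simp: carrier_cycles carrier_homology_at)

text \<open>Taking the class of a cycle is a homomorphism. This brings the signs of
  \<open>mac_differential\<close>, which are exponents in a quotient group, down to coefficients of
  chains.\<close>

lemma class_int_pow: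
  fixes n :: int
  assumes "z \<in> kernel B C g"
  shows "(f ` carrier A #>\<^bsub>B\<^esub> z) [^]\<^bsub>homology_at A f B g C\<^esub> n = f ` carrier A #>\<^bsub>B\<^esub> (z [^]\<^bsub>B\<^esub> n)"
  using hom_int_pow[OF class_hom, of z n] assms
    group.int_pow_subgroup_generated[OF group_B, of z "kernel B C g" n]
  by (simp add: carrier_cycles group_B group.group_subgroup_generated group_homology_at)

end

text \<open>Two representatives differ by some \<open>u\<close> in \<open>M\<close>, and
  \<open>h u\<close> lies in \<open>N\<close>; hence all the cosets in the union defining the
  induced map coincide.\<close>

lemma induced_on_classes_coset:
  assumes "group A" "group B" and h: "h \<in> hom A B"
    and M: "subgroup M A" and N: "subgroup N B" and "h ` M \<subseteq> N" and z: "z \<in> carrier A"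
  shows "induced_on_classes B N h (M #>\<^bsub>A\<^esub> z) = N #>\<^bsub>B\<^esub> h z"
proof -
  have "N #>\<^bsub>B\<^esub> h y = N #>\<^bsub>B\<^esub> h z" if y: "y \<in> M #>\<^bsub>A\<^esub> z" for y
  proof -
    obtain u where u: "u \<in> M" "y = u \<otimes>\<^bsub>A\<^esub> z"
      using y by (auto simp: r_coset_def)
    then have "h y = h u \<otimes>\<^bsub>B\<^esub> h z"
      using hom_mult[OF h subgroup.mem_carrier[OF M u(1)] z] by simp
    moreover have "h u \<in> N"
      using u(1) \<open>h ` M \<subseteq> N\<close> by blast
    ultimately have "h y \<in> N #>\<^bsub>B\<^esub> h z"
      by (auto simp: r_coset_def)
    then show ?thesis
      using group.repr_independence[OF assms(2) _ _ N] hom_in_carrier[OF h z] by simp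
  qed
  moreover have "z \<in> M #>\<^bsub>A\<^esub> z"
    by (rule group.rcos_self) fact+
  ultimately show ?thesis
    unfolding induced_on_classes_def by blast
qed

section \<open>Homology of finite direct sums\<close>

lemma carrier_sum_group_finite:
  assumes "finite T" "\<And>S. S \<in> T \<Longrightarrow> group (G S)"
  shows "carrier (sum_group T G) = (\<Pi>\<^sub>E S\<in>T. carrier (G S))"
  using assms by (simp add: carrier_sum_group)

lemma comm_group_sum_group:
  assumes "finite T" and comm: "\<And>S. S \<in> T \<Longrightarrow> comm_group (G S)"
  shows "comm_group (sum_group T G)"
proof -
  have grp: "group (G S)" if "S \<in> T" for S
    using comm[OF that] by (simp add: comm_group_def)
  show ?thesis
  proof (rule group.group_comm_groupI)
    show "x \<otimes>\<^bsub>sum_group T G\<^esub> y = y \<otimes>\<^bsub>sum_group T G\<^esub> x"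
      if xy: "x \<in> carrier (sum_group T G)" "y \<in> carrier (sum_group T G)" for x y
    proof -
      have "x S \<otimes>\<^bsub>G S\<^esub> y S = y S \<otimes>\<^bsub>G S\<^esub> x S" if S: "S \<in> T" for S
      proof (rule comm_monoid.m_comm)
        show "comm_monoid (G S)"
          using comm[OF S] by (simp add: comm_group_def)
        show "x S \<in> carrier (G S)" "y S \<in> carrier (G S)"
          using S xy by (auto simp: carrier_sum_group_finite[OF assms(1) grp] PiE_iff)
      qed
      then show ?thesis
        by (auto intro: restrict_ext)
    qed
  qed (use grp in simp)
qed

locale homology_pair_family =
  fixes T :: "'s set" and A :: "'s \<Rightarrow> 'a monoid" and f :: "'s \<Rightarrow> 'a \<Rightarrow> 'b"
    and B :: "'s \<Rightarrow> 'b monoid" and g :: "'s \<Rightarrow> 'b \<Rightarrow> 'c" and C :: "'s \<Rightarrow> 'c monoid"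
  assumes finT: "finite T"
    and pair: "\<And>S. S \<in> T \<Longrightarrow> homology_pair (A S) (f S) (B S) (g S) (C S)"
begin

abbreviation "F \<equiv> \<lambda>x. \<lambda>S\<in>T. f S (x S)"
abbreviation "G \<equiv> \<lambda>x. \<lambda>S\<in>T. g S (x S)"

lemma groups:
  assumes "S \<in> T"
  shows "group (A S)" "group (B S)" "comm_group (B S)" "group (C S)"
  using homology_pair.grpA[OF pair[OF assms]] homology_pair.group_B[OF pair[OF assms]]
    homology_pair.commB[OF pair[OF assms]] homology_pair.grpC[OF pair[OF assms]] by simp_all

lemma carriers:
  "carrier (sum_group T A) = (\<Pi>\<^sub>E S\<in>T. carrier (A S))"
  "carrier (sum_group T B) = (\<Pi>\<^sub>E S\<in>T. carrier (B S))"
  "carrier (sum_group T C) = (\<Pi>\<^sub>E S\<in>T. carrier (C S))"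
  by (simp_all add: carrier_sum_group_finite finT groups)

lemma componentwise_hom:
  assumes "\<And>S. S \<in> T \<Longrightarrow> group (X S)" "\<And>S. S \<in> T \<Longrightarrow> group (Y S)"
    and h: "\<And>S. S \<in> T \<Longrightarrow> h S \<in> hom (X S) (Y S)"
  shows "(\<lambda>x. \<lambda>S\<in>T. h S (x S)) \<in> hom (sum_group T X) (sum_group T Y)"
proof (rule homI)
  note carr = carrier_sum_group_finite[OF finT assms(1)] carrier_sum_group_finite[OF finT assms(2)]
  show "(\<lambda>S\<in>T. h S (x S)) \<in> carrier (sum_group T Y)" if "x \<in> carrier (sum_group T X)" for x
    using that hom_in_carrier[OF h] by (simp add: carr PiE_iff)
  show "(\<lambda>S\<in>T. h S ((x \<otimes>\<^bsub>sum_group T X\<^esub> y) S))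
      = (\<lambda>S\<in>T. h S (x S)) \<otimes>\<^bsub>sum_group T Y\<^esub> (\<lambda>S\<in>T. h S (y S))"
    if "x \<in> carrier (sum_group T X)" "y \<in> carrier (sum_group T X)" for x y
    using that hom_mult[OF h] by (auto simp: carr PiE_iff intro!: restrict_ext)
qed

lemma pair_sum_group: "homology_pair (sum_group T A) F (sum_group T B) G (sum_group T C)"
proof (rule homology_pair.intro)
  show "group (sum_group T A)" "group (sum_group T C)"
    using groups by simp_all
  show "comm_group (sum_group T B)"
    using groups finT by (intro comm_group_sum_group)
  show "F \<in> hom (sum_group T A) (sum_group T B)" "G \<in> hom (sum_group T B) (sum_group T C)"
    using groups homology_pair.homf[OF pair] homology_pair.homg[OF pair]
    by (intro componentwise_hom; simp)+
  show "G (F x) = \<one>\<^bsub>sum_group T C\<^esub>" if "x \<in> carrier (sum_group T A)" for x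
    using that homology_pair.gf[OF pair] by (auto simp: carriers PiE_iff intro!: restrict_ext)
qed

lemma kernel_sum_group:
  "kernel (sum_group T B) (sum_group T C) G = (\<Pi>\<^sub>E S\<in>T. kernel (B S) (C S) (g S))"
proof -
  have "(\<lambda>S\<in>T. g S (x S)) = (\<lambda>S\<in>T. \<one>\<^bsub>C S\<^esub>) \<longleftrightarrow> (\<forall>S\<in>T. g S (x S) = \<one>\<^bsub>C S\<^esub>)" for x
    by (auto simp: fun_eq_iff restrict_def)
  then show ?thesis
    by (auto simp: kernel_def carriers PiE_iff extensional_def)
qed

lemma image_sum_group:
  "F ` carrier (sum_group T A) = (\<Pi>\<^sub>E S\<in>T. f S ` carrier (A S))"
proof (intro equalityI subsetI)
  fix y assume y: "y \<in> (\<Pi>\<^sub>E S\<in>T. f S ` carrier (A S))"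
  then have "\<forall>S\<in>T. \<exists>a. a \<in> carrier (A S) \<and> y S = f S a"
    by (auto simp: PiE_iff)
  then obtain a where a: "\<forall>S\<in>T. a S \<in> carrier (A S) \<and> y S = f S (a S)"
    by metis
  have "y = F (restrict a T)"
    using y a by (auto simp: PiE_iff extensional_def fun_eq_iff)
  moreover have "restrict a T \<in> carrier (sum_group T A)"
    using a by (simp add: carriers)
  ultimately show "y \<in> F ` carrier (sum_group T A)"
    by blast
qed (auto simp: carriers PiE_iff)

text \<open>Boundaries can be chosen independently in each component, so every family of component
  representatives is a representative of the whole class. This is the concrete form in which
  homology commutes with finite direct sums.\<close>

lemma coset_sum_group:
  assumes x: "x \<in> carrier (sum_group T B)"
  shows "F ` carrier (sum_group T A) #>\<^bsub>sum_group T B\<^esub> x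
    = (\<Pi>\<^sub>E S\<in>T. f S ` carrier (A S) #>\<^bsub>B S\<^esub> x S)"
proof (intro equalityI subsetI)
  fix y assume y: "y \<in> (\<Pi>\<^sub>E S\<in>T. f S ` carrier (A S) #>\<^bsub>B S\<^esub> x S)"
  then have "\<forall>S\<in>T. \<exists>n. n \<in> f S ` carrier (A S) \<and> y S = n \<otimes>\<^bsub>B S\<^esub> x S"
    by (force simp: PiE_iff r_coset_def)
  then obtain n where n: "\<forall>S\<in>T. n S \<in> f S ` carrier (A S) \<and> y S = n S \<otimes>\<^bsub>B S\<^esub> x S"
    by metis
  have "y = restrict n T \<otimes>\<^bsub>sum_group T B\<^esub> x"
    using y n by (auto simp: PiE_iff extensional_def fun_eq_iff)
  moreover have "restrict n T \<in> F ` carrier (sum_group T A)"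
    using n unfolding image_sum_group by auto
  ultimately show "y \<in> F ` carrier (sum_group T A) #>\<^bsub>sum_group T B\<^esub> x"
    unfolding r_coset_def by blast
next
  fix y assume "y \<in> F ` carrier (sum_group T A) #>\<^bsub>sum_group T B\<^esub> x"
  then obtain n where "n \<in> (\<Pi>\<^sub>E S\<in>T. f S ` carrier (A S))" "y = n \<otimes>\<^bsub>sum_group T B\<^esub> x"
    unfolding r_coset_def image_sum_group by blast
  then show "y \<in> (\<Pi>\<^sub>E S\<in>T. f S ` carrier (A S) #>\<^bsub>B S\<^esub> x S)"
    by (force simp: PiE_iff r_coset_def)
qed

end

section \<open>Reduced simplicial homology\<close>

lemma boundary_simps [simp]:
  "boundary 0 = 0"
  "boundary (a + b) = boundary a + boundary b"
  "boundary (- a) = - boundary a"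
  "boundary (a - b) = boundary a - boundary b"
  "boundary (frag_cmul n a) = frag_cmul n (boundary a)"
  by (simp_all add: boundary_def frag_extend_add frag_extend_minus frag_extend_diff frag_extend_cmul)

lemma boundary_sum: "boundary (sum z J) = (\<Sum>j\<in>J. boundary (z j))"
  by (induction J rule: infinite_finite_induct) auto

text \<open>Removing the smaller vertex moves the larger one down by one place, removing the larger
  one leaves the smaller in place. This asymmetry produces the opposite signs in a double
  boundary.\<close>

lemma card_less_remove:
  fixes u w :: "'v::linorder"
  assumes "finite \<sigma>" "w \<in> \<sigma>" "u \<in> \<sigma>" "u < w"
  shows "card {x \<in> \<sigma>. x < w} = Suc (card {x \<in> \<sigma> - {u}. x < w})"
    and "{x \<in> \<sigma> - {w}. x < u} = {x \<in> \<sigma>. x < u}"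
proof -
  have "{x \<in> \<sigma>. x < w} = insert u {x \<in> \<sigma> - {u}. x < w}"
    using assms(3,4) by blast
  then have "card {x \<in> \<sigma>. x < w} = card (insert u {x \<in> \<sigma> - {u}. x < w})"
    by (rule arg_cong)
  also have "\<dots> = Suc (card {x \<in> \<sigma> - {u}. x < w})"
    using assms(1) by (intro card_insert_disjoint) auto
  finally show "card {x \<in> \<sigma>. x < w} = Suc (card {x \<in> \<sigma> - {u}. x < w})" .
  show "{x \<in> \<sigma> - {w}. x < u} = {x \<in> \<sigma>. x < u}"
    using order.asym[OF assms(4)] by blast
qed

text \<open>The integers have no 2-torsion, so the claim holds coefficient by coefficient.\<close>

lemma frag_eq_uminus_self:
  fixes c :: "'b \<Rightarrow>\<^sub>0 int"
  assumes "c = - c"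
  shows "c = 0"
proof (rule poly_mapping_eqI)
  fix i
  have "poly_mapping.lookup c i = - poly_mapping.lookup c i"
    by (subst assms) (rule lookup_uminus)
  then show "poly_mapping.lookup c i = poly_mapping.lookup 0 i"
    by simp
qed

text \<open>Exchanging the two summation variables permutes the off-diagonal pairs and negates every
  term, so the sum equals its own negative.\<close>

lemma sum_off_diagonal_antisym:
  fixes F :: "'v \<Rightarrow> 'v \<Rightarrow> ('b \<Rightarrow>\<^sub>0 int)"
  assumes "finite \<sigma>" and anti: "\<And>u w. u \<in> \<sigma> \<Longrightarrow> w \<in> \<sigma> \<Longrightarrow> u \<noteq> w \<Longrightarrow> F u w = - F w u"
  shows "(\<Sum>w\<in>\<sigma>. \<Sum>u\<in>\<sigma>-{w}. F w u) = 0"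
proof -
  let ?S = "SIGMA w:\<sigma>. \<sigma> - {w}"
  have "(\<Sum>(w,u)\<in>?S. F w u) = (\<Sum>(w,u)\<in>?S. F u w)"
    by (rule sum.reindex_bij_witness[of _ "\<lambda>(a,b). (b,a)" "\<lambda>(a,b). (b,a)"]) auto
  also have "\<dots> = (\<Sum>(w,u)\<in>?S. - F w u)"
    by (rule sum.cong) (use anti in auto)
  also have "\<dots> = - (\<Sum>(w,u)\<in>?S. F w u)"
    by (simp add: case_prod_unfold sum_negf)
  finally have "(\<Sum>(w,u)\<in>?S. F w u) = 0"
    by (rule frag_eq_uminus_self)
  then show ?thesis
    using assms(1) by (simp add: sum.Sigma)
qed

lemma boundary_boundary_simplex:
  fixes \<sigma> :: "'v::linorder set"
  assumes "finite \<sigma>"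
  shows "boundary (boundary (frag_of \<sigma>)) = 0"
proof -
  let ?s = "\<lambda>w \<tau>. (-1) ^ card {x \<in> \<tau>. x < w} :: int"
  \<comment> \<open>The contribution of deleting \<open>w\<close> first and \<open>u\<close> second;
    the other order leaves the same face.\<close>
  let ?F = "\<lambda>w u. frag_cmul (?s w \<sigma> * ?s u (\<sigma> - {w})) (frag_of (\<sigma> - {w} - {u}))"
  have of: "boundary (frag_of \<tau>) = (\<Sum>w\<in>\<tau>. frag_cmul (?s w \<tau>) (frag_of (\<tau> - {w})))" for \<tau> :: "'v set"
    by (simp add: boundary_def)
  have anti: "?F u w = - ?F w u" if "u \<in> \<sigma>" "w \<in> \<sigma>" "u \<noteq> w" for u w
  proof -
    have "?s u \<sigma> * ?s w (\<sigma> - {u}) = - (?s w \<sigma> * ?s u (\<sigma> - {w}))"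
    proof (cases u w rule: linorder_cases)
      case less
      then show ?thesis
        using card_less_remove[OF assms that(2,1) less] by simp
    next
      case greater
      then show ?thesis
        using card_less_remove[OF assms that(1,2) greater] by simp
    qed (use that(3) in auto)
    then show ?thesis
      unfolding Diff_insert2[symmetric] by (simp add: insert_commute)
  qed
  have "boundary (boundary (frag_of \<sigma>)) = (\<Sum>w\<in>\<sigma>. \<Sum>u\<in>\<sigma>-{w}. ?F w u)"
    by (simp add: of boundary_sum frag_cmul_sum)
  also have "\<dots> = 0"
    using anti by (rule sum_off_diagonal_antisym[OF assms])
  finally show ?thesis .
qed

lemma boundary_boundary:
  assumes "\<And>\<sigma>. \<sigma> \<in> Poly_Mapping.keys c \<Longrightarrow> finite \<sigma>"
  shows "boundary (boundary c) = 0"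
proof -
  have "Poly_Mapping.keys c \<subseteq> {\<sigma>. finite \<sigma>}"
    using assms by blast
  then show ?thesis
    by (induction c rule: frag_induction) (auto simp: boundary_boundary_simplex)
qed

section \<open>Chain groups of a complex\<close>

lemma chain_group_simps [simp]:
  "x \<otimes>\<^bsub>chain_group K q\<^esub> y = x + y"
  "\<one>\<^bsub>chain_group K q\<^esub> = 0"
  "group (chain_group K q)"
  "comm_group (chain_group K q)"
  by (simp_all add: chain_group_def abelian_free_Abelian_group)

lemma carrier_chain_group:
  "c \<in> carrier (chain_group K q) \<longleftrightarrow> Poly_Mapping.keys c \<subseteq> {\<sigma> \<in> K. int (card \<sigma>) = q + 1}"
  by (simp add: chain_group_def)

lemma int_pow_chain_group:
  fixes n :: int
  shows "c \<in> carrier (chain_group K q) \<Longrightarrow> c [^]\<^bsub>chain_group K q\<^esub> n = frag_cmul n c"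
  by (simp add: chain_group_def)

lemma chain_group_closed:
  "c \<in> carrier (chain_group K q) \<Longrightarrow> frag_cmul n c \<in> carrier (chain_group K q)"
  "(\<And>j. j \<in> J \<Longrightarrow> z j \<in> carrier (chain_group K q)) \<Longrightarrow> sum z J \<in> carrier (chain_group K q)"
  using keys_cmul sum_closed_free_Abelian_group[of J z] by (force simp: chain_group_def)+

lemma boundary_in_chain_group:
  assumes K: "simplicial_complex V K" and c: "c \<in> carrier (chain_group K q)"
  shows "boundary c \<in> carrier (chain_group K (q - 1))"
  unfolding carrier_chain_group
proof
  fix \<tau> assume \<tau>: "\<tau> \<in> Poly_Mapping.keys (boundary c)"
  obtain \<sigma> where \<sigma>: "\<sigma> \<in> Poly_Mapping.keys c"
    and "\<tau> \<in> Poly_Mapping.keys (\<Sum>w\<in>\<sigma>. frag_cmul ((-1) ^ card {u \<in> \<sigma>. u < w}) (frag_of (\<sigma> - {w})))"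
    using \<tau> keys_frag_extend unfolding boundary_def by fast
  then obtain w where w: "w \<in> \<sigma>" "\<tau> = \<sigma> - {w}"
    using keys_sum by (fastforce split: if_splits)
  have "\<sigma> \<in> K" "int (card \<sigma>) = q + 1"
    using \<sigma> c by (auto simp: carrier_chain_group)
  \<comment> \<open>Finiteness is what makes the size drop by one: \<open>card\<close> of an
    infinite set is 0, also after removing a vertex.\<close>
  moreover have "finite \<sigma>"
    using K \<open>\<sigma> \<in> K\<close> by (auto simp: simplicial_complex_def intro: finite_subset)
  then have "int (card \<sigma>) = int (card \<tau>) + 1"
    using w card.remove[of \<sigma> w] by simp
  moreover have "\<tau> \<in> K"
    using K \<open>\<sigma> \<in> K\<close> w unfolding simplicial_complex_def by blast
  ultimately show "\<tau> \<in> {\<sigma> \<in> K. int (card \<sigma>) = q - 1 + 1}"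
    by simp
qed

lemma homology_pair_chain_group:
  assumes K: "simplicial_complex V K"
  shows "homology_pair (chain_group K (q + 1)) boundary (chain_group K q) boundary (chain_group K (q - 1))"
proof (rule homology_pair.intro)
  show "boundary \<in> hom (chain_group K (q + 1)) (chain_group K q)"
    "boundary \<in> hom (chain_group K q) (chain_group K (q - 1))"
    using boundary_in_chain_group[OF K] boundary_in_chain_group[OF K, of _ "q + 1"]
    by (auto intro!: homI)
  show "boundary (boundary c) = \<one>\<^bsub>chain_group K (q - 1)\<^esub>" if "c \<in> carrier (chain_group K (q + 1))" for c
  proof -
    have "finite \<sigma>" if "\<sigma> \<in> Poly_Mapping.keys c" for \<sigma>
      using that K \<open>c \<in> carrier (chain_group K (q + 1))\<close>
      by (auto simp: carrier_chain_group simplicial_complex_def intro: finite_subset)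
    then show ?thesis
      using boundary_boundary[of c] by simp
  qed
qed simp_all

lemma simplicial_complex_full_subcomplex:
  "simplicial_complex V K \<Longrightarrow> simplicial_complex V (full_subcomplex K I)"
  unfolding simplicial_complex_def full_subcomplex_def by blast

lemma chain_group_mono: "L \<subseteq> K \<Longrightarrow> carrier (chain_group L q) \<subseteq> carrier (chain_group K q)"
  unfolding subset_iff carrier_chain_group by blast

lemma full_subcomplex_mono: "I \<subseteq> J \<Longrightarrow> full_subcomplex K I \<subseteq> full_subcomplex K J"
  by (auto simp: full_subcomplex_def)

section \<open>Homology classes of chains\<close>

text \<open>Makes sense for every chain, not only for cycles, so sums and signs can be computed
  separately from membership in \<open>cycles\<close>.\<close>

definition hclass :: "int \<Rightarrow> 'v::linorder set set \<Rightarrow> ('v set \<Rightarrow>\<^sub>0 int) \<Rightarrow> ('v set \<Rightarrow>\<^sub>0 int) set"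
  where "hclass q K z = boundary ` carrier (chain_group K (q + 1)) #>\<^bsub>chain_group K q\<^esub> z"

abbreviation cycles :: "int \<Rightarrow> 'v::linorder set set \<Rightarrow> ('v set \<Rightarrow>\<^sub>0 int) set"
  where "cycles q K \<equiv> kernel (chain_group K q) (chain_group K (q - 1)) boundary"

lemma cycles_iff: "z \<in> cycles q K \<longleftrightarrow> z \<in> carrier (chain_group K q) \<and> boundary z = 0"
  by (simp add: kernel_def)

lemma cycles_closed:
  "z \<in> cycles q K \<Longrightarrow> frag_cmul n z \<in> cycles q K"
  "(\<And>j. j \<in> J \<Longrightarrow> y j \<in> cycles q K) \<Longrightarrow> sum y J \<in> cycles q K"
  by (auto simp: cycles_iff chain_group_closed boundary_sum)

lemma cycles_mono: "L \<subseteq> K \<Longrightarrow> cycles q L \<subseteq> cycles q K"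
  using chain_group_mono[of L K q] by (auto simp: cycles_iff)

lemma hclass_eq: "hclass q K z = (\<lambda>c. boundary c + z) ` carrier (chain_group K (q + 1))"
  by (auto simp: hclass_def r_coset_def)

lemma hclass_nonempty: "hclass q K z \<noteq> {}"
proof -
  have "0 \<in> carrier (chain_group K (q + 1))"
    by (simp add: carrier_chain_group)
  then show ?thesis
    unfolding hclass_eq by blast
qed

text \<open>Multiplication by a sign permutes the chains of degree \<open>q + 1\<close> and hence
  the boundaries, so acting on all representatives of a class yields a full class again. For a
  general integer the image could be a proper part of a class.\<close>

lemma sign_image_hclass:
  assumes "e * e = 1"
  shows "frag_cmul e ` hclass q K z = hclass q K (frag_cmul e z)"
proof -
  let ?C = "carrier (chain_group K (q + 1))"
  have "frag_cmul e ` ?C = ?C"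
  proof
    show "?C \<subseteq> frag_cmul e ` ?C"
    proof
      fix c assume "c \<in> ?C"
      then have "frag_cmul e c \<in> ?C" "c = frag_cmul e (frag_cmul e c)"
        using assms chain_group_closed by simp_all
      then show "c \<in> frag_cmul e ` ?C"
        by blast
    qed
  qed (use chain_group_closed in blast)
  then have "hclass q K (frag_cmul e z) = (\<lambda>c. boundary c + frag_cmul e z) ` frag_cmul e ` ?C"
    by (simp add: hclass_eq)
  also have "\<dots> = frag_cmul e ` hclass q K z"
    by (simp add: hclass_eq image_image frag_cmul_distrib2)
  finally show ?thesis ..
qed

context
  fixes V :: "'v::linorder set" and K :: "'v set set"
  assumes K: "simplicial_complex V K"
begin

interpretation homology_pair "chain_group K (q + 1)" boundary "chain_group K q" boundary "chain_group K (q - 1)"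
  for q
  by (rule homology_pair_chain_group[OF K])

lemma comm_group_reduced_homology: "comm_group (reduced_homology q K)"
  unfolding reduced_homology_def by (rule comm_group_homology_at)

lemma carrier_reduced_homology: "carrier (reduced_homology q K) = hclass q K ` cycles q K"
  unfolding reduced_homology_def carrier_homology_at hclass_def ..

lemma mult_reduced_homology:
  assumes "z \<in> carrier (chain_group K q)" "w \<in> carrier (chain_group K q)"
  shows "hclass q K z \<otimes>\<^bsub>reduced_homology q K\<^esub> hclass q K w = hclass q K (z + w)"
  using mult_homology_at[OF assms] unfolding reduced_homology_def hclass_def by simp

lemma one_reduced_homology: "\<one>\<^bsub>reduced_homology q K\<^esub> = hclass q K 0"
  using one_homology_at unfolding reduced_homology_def hclass_def by simp

lemma int_pow_reduced_homology:
  fixes n :: int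
  assumes "z \<in> cycles q K"
  shows "hclass q K z [^]\<^bsub>reduced_homology q K\<^esub> n = hclass q K (frag_cmul n z)"
  using class_int_pow[OF assms, of n] assms
  unfolding reduced_homology_def hclass_def by (simp add: int_pow_chain_group cycles_iff)

text \<open>Turns the product in \<open>mac_differential\<close> into the class of one sum of
  chains, where it can be compared with the horizontal differential.\<close>

lemma finprod_reduced_homology:
  assumes "finite J" and "\<And>j. j \<in> J \<Longrightarrow> z j \<in> cycles q K"
  shows "finprod (reduced_homology q K) (\<lambda>j. hclass q K (z j)) J = hclass q K (\<Sum>j\<in>J. z j)"
proof -
  interpret comm_monoid "reduced_homology q K"
    using comm_group_reduced_homology[of q] by (simp add: comm_group_def)
  show ?thesis
    using assms
  proof (induction J rule: finite_induct)
    case (insert j J)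
    then have "(\<lambda>j. hclass q K (z j)) \<in> J \<rightarrow> carrier (reduced_homology q K)"
      "hclass q K (z j) \<in> carrier (reduced_homology q K)"
      by (auto simp: carrier_reduced_homology)
    moreover have "z j \<in> carrier (chain_group K q)" "sum z J \<in> carrier (chain_group K q)"
      using insert.prems by (auto simp: cycles_iff intro: chain_group_closed)
    ultimately show ?case
      using insert by (simp add: mult_reduced_homology)
  qed (simp add: one_reduced_homology)
qed

lemma hclass_in_reduced_homology:
  "z \<in> cycles q K \<Longrightarrow> hclass q K z \<in> carrier (reduced_homology q K)"
  by (simp add: carrier_reduced_homology)

lemma subgroup_boundaries:
  "subgroup (boundary ` carrier (chain_group K (q + 1))) (chain_group K q)"
  by (rule subgroup_image)

end

text \<open>Chains of \<open>L\<close> are chains of \<open>K\<close>, so boundaries in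
  \<open>L\<close> remain boundaries in \<open>K\<close> and the identity on chains passes to
  classes.\<close>

lemma inclusion_induced_hclass:
  assumes K: "simplicial_complex V K" and L: "simplicial_complex W L" and "L \<subseteq> K"
    and z: "z \<in> carrier (chain_group L q)"
  shows "inclusion_induced q K (hclass q L z) = hclass q K z"
proof -
  have "id \<in> hom (chain_group L q) (chain_group K q)"
    using chain_group_mono[OF \<open>L \<subseteq> K\<close>, of q] by (auto intro!: homI)
  then have "induced_on_classes (chain_group K q) (boundary ` carrier (chain_group K (q + 1))) id
      (boundary ` carrier (chain_group L (q + 1)) #>\<^bsub>chain_group L q\<^esub> z)
    = boundary ` carrier (chain_group K (q + 1)) #>\<^bsub>chain_group K q\<^esub> id z"
    using chain_group_mono[OF \<open>L \<subseteq> K\<close>, of "q + 1"] z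
    by (intro induced_on_classes_coset subgroup_boundaries[OF K] subgroup_boundaries[OF L]) auto
  then show ?thesis
    by (simp add: inclusion_induced_def hclass_def)
qed

section \<open>The first page and the homology of the moment-angle complex\<close>

text \<open>For \<open>j \<in> J\<close>, the position of \<open>j\<close> in \<open>V\<close> is the number of smaller elements of \<open>J\<close> plus the number of
  smaller elements of \<open>V - J\<close>. The double homology differential uses the first number and the
  Mayer--Vietoris differential the second, so the two differ by a sign depending on \<open>j\<close> alone, which
  a diagonal change of signs absorbs.\<close>

definition reorder_sign :: "'v::linorder set \<Rightarrow> int \<Rightarrow> 'v set \<Rightarrow> int"
  where "reorder_sign V q S = (\<Prod>s\<in>S. (-1) ^ (nat \<bar>q + 1\<bar> + card {u \<in> V. u < s}))"

lemma reorder_sign_square: "reorder_sign V q S * reorder_sign V q S = 1"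
  by (simp add: reorder_sign_def flip: prod.distrib power_add)

text \<open>The coefficients of the \<open>j\<close>-th term along the two ways around the square
  agree. On the left stands the Mayer--Vietoris sign followed by the rescaling of the target, on the
  right the rescaling of the source followed by the double homology sign. Passing from
  \<open>V - J\<close> to \<open>insert j (V - J)\<close> adds one factor to
  \<open>reorder_sign\<close>, with exponent \<open>?n + ?a + ?b\<close>; multiplied by the signs
  for \<open>?n\<close> and \<open>?a\<close> it leaves the sign for \<open>?b\<close>.\<close>

lemma reorder_sign_insert:
  fixes V :: "'v::linorder set"
  assumes V: "finite V" and J: "J \<subseteq> V" "j \<in> J"
  shows "reorder_sign V q (V - J) * (-1) ^ card {u \<in> insert j (V - J). u < j}
    = (-1) ^ nat \<bar>q + 1\<bar> * (-1) ^ card {i \<in> J - {j}. i < j} * reorder_sign V q (insert j (V - J))"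
proof -
  let ?a = "card {i \<in> J - {j}. i < j}" and ?b = "card {u \<in> insert j (V - J). u < j}"
    and ?n = "nat \<bar>q + 1\<bar>"
  have "{u \<in> V. u < j} = {i \<in> J - {j}. i < j} \<union> {u \<in> insert j (V - J). u < j}"
    using J by auto
  moreover have "card ({i \<in> J - {j}. i < j} \<union> {u \<in> insert j (V - J). u < j}) = ?a + ?b"
    using V finite_subset[OF J(1) V] by (intro card_Un_disjoint) auto
  ultimately have "card {u \<in> V. u < j} = ?a + ?b"
    by simp
  moreover have "reorder_sign V q (insert j (V - J))
      = (-1) ^ (?n + card {u \<in> V. u < j}) * reorder_sign V q (V - J)"
    unfolding reorder_sign_def using V J by (subst prod.insert) auto
  ultimately have "(-1) ^ ?n * (-1) ^ ?a * reorder_sign V q (insert j (V - J))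
      = (((-1) ^ ?n * (-1) ^ ?n) * ((-1) ^ ?a * (-1) ^ ?a)) * ((-1) ^ ?b * reorder_sign V q (V - J))"
    by (simp only: power_add mult_ac)
  also have "\<dots> = reorder_sign V q (V - J) * (-1) ^ ?b"
    by (simp flip: power_add)
  finally show ?thesis ..
qed

section \<open>Cycles and classes on the first page, by components\<close>

text \<open>The use of \<open>\<Pi>\<^sub>E\<close> makes this a set of families, not a family of
  sets: it is literally the coset of \<open>x\<close> in the direct sum, as \<open>mv_coset\<close>
  confirms.\<close>

definition mv_class ::
  "'v::linorder set \<Rightarrow> 'v set set \<Rightarrow> int \<Rightarrow> int
    \<Rightarrow> ('v set \<Rightarrow> ('v set \<Rightarrow>\<^sub>0 int)) \<Rightarrow> ('v set \<Rightarrow> ('v set \<Rightarrow>\<^sub>0 int)) set"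
  where "mv_class V K p q x =
    (\<Pi>\<^sub>E S\<in>subsets_of_size V (p + 1). hclass q (full_subcomplex K (V - S)) (x S))"

definition mv_cycles ::
  "'v::linorder set \<Rightarrow> 'v set set \<Rightarrow> int \<Rightarrow> int \<Rightarrow> ('v set \<Rightarrow> ('v set \<Rightarrow>\<^sub>0 int)) set"
  where "mv_cycles V K p q =
    (\<Pi>\<^sub>E S\<in>subsets_of_size V (p + 1). cycles q (full_subcomplex K (V - S)))"

text \<open>The argument \<open>c\<close> is a set of families; each component collects the rescaled
  values at \<open>V - I\<close> over all of \<open>c\<close>, which avoids a choice of
  representative.\<close>

definition page1_to_mac ::
  "'v::linorder set \<Rightarrow> int \<Rightarrow> int \<Rightarrow> ('v set \<Rightarrow> ('v set \<Rightarrow>\<^sub>0 int)) set \<Rightarrow> ('v set \<Rightarrow> ('v set \<Rightarrow>\<^sub>0 int) set)"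
  where "page1_to_mac V q l c =
    (\<lambda>I\<in>subsets_of_size V l. (\<lambda>x. frag_cmul (reorder_sign V q (V - I)) (x (V - I))) ` c)"

context
  fixes V :: "'v::linorder set" and K :: "'v set set"
  assumes K: "simplicial_complex V K"
begin

lemma finite_V: "finite V"
  using K by (simp add: simplicial_complex_def)

lemma finite_subsets_of_size: "finite (subsets_of_size V n)"
  using finite_V by (simp add: subsets_of_size_def)

text \<open>Complementation exchanges the sizes \<open>l\<close> and
  \<open>card V - l = p + 1\<close>. For \<open>l\<close> negative or larger than
  \<open>card V\<close> both families are empty.\<close>

lemma Diff_in_subsets_of_size:
  assumes "I \<in> subsets_of_size V l" "p = int (card V) - l - 1"
  shows "V - I \<in> subsets_of_size V (p + 1)"
proof -
  have "card I \<le> card V" "card (V - I) = card V - card I"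
    using assms finite_V by (auto simp: subsets_of_size_def card_mono card_Diff_subset finite_subset)
  then show ?thesis
    using assms by (auto simp: subsets_of_size_def)
qed

lemma Diff_in_subsets_of_size':
  assumes "S \<in> subsets_of_size V (p + 1)" "p = int (card V) - l - 1"
  shows "V - S \<in> subsets_of_size V l"
proof -
  have "card S \<le> card V" "card (V - S) = card V - card S"
    using assms finite_V by (auto simp: subsets_of_size_def card_mono card_Diff_subset finite_subset)
  then show ?thesis
    using assms by (auto simp: subsets_of_size_def)
qed

text \<open>A simplex of \<open>K\<close> survives exactly if it avoids every vertex of
  \<open>S\<close>. For empty \<open>S\<close> the right side is all of \<open>K\<close> because
  simplices lie in \<open>V\<close>.\<close>

lemma cover_intersection_anti_star:
  "cover_intersection K (anti_star V K) S = full_subcomplex K (V - S)"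
  using K by (fastforce simp: cover_intersection_def anti_star_def full_subcomplex_def simplicial_complex_def)

lemma mv_complex_anti_star:
  "mv_complex V K (anti_star V K) p q
    = sum_group (subsets_of_size V (p + 1)) (\<lambda>S. chain_group (full_subcomplex K (V - S)) q)"
  by (simp add: mv_complex_def cover_intersection_anti_star)

interpretation mv: homology_pair_family "subsets_of_size V (p + 1)"
  "\<lambda>S. chain_group (full_subcomplex K (V - S)) (q + 1)" "\<lambda>S. boundary"
  "\<lambda>S. chain_group (full_subcomplex K (V - S)) q" "\<lambda>S. boundary"
  "\<lambda>S. chain_group (full_subcomplex K (V - S)) (q - 1)" for p q
  by (intro homology_pair_family.intro finite_subsets_of_size
      homology_pair_chain_group[OF simplicial_complex_full_subcomplex[OF K]])

lemma mv_vertical_eq: "mv_vertical V p = (\<lambda>x. \<lambda>S\<in>subsets_of_size V (p + 1). boundary (x S))"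
  by (simp add: mv_vertical_def fun_eq_iff)

lemma homology_pair_mv_complex:
  "homology_pair (mv_complex V K (anti_star V K) p (q + 1)) (mv_vertical V p)
    (mv_complex V K (anti_star V K) p q) (mv_vertical V p)
    (mv_complex V K (anti_star V K) p (q - 1))"
  unfolding mv_complex_anti_star mv_vertical_eq by (rule mv.pair_sum_group)

lemma carrier_mv_complex:
  "carrier (mv_complex V K (anti_star V K) p q)
    = (\<Pi>\<^sub>E S\<in>subsets_of_size V (p + 1). carrier (chain_group (full_subcomplex K (V - S)) q))"
  unfolding mv_complex_anti_star by (rule mv.carriers)

lemma mv_coset:
  assumes "x \<in> carrier (mv_complex V K (anti_star V K) p q)"
  shows "mv_vertical V p ` carrier (mv_complex V K (anti_star V K) p (q + 1))
      #>\<^bsub>mv_complex V K (anti_star V K) p q\<^esub> x = mv_class V K p q x"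
  using mv.coset_sum_group assms unfolding mv_complex_anti_star mv_vertical_eq mv_class_def hclass_def
  by blast

lemma mv_kernel:
  "kernel (mv_complex V K (anti_star V K) p q) (mv_complex V K (anti_star V K) p (q - 1)) (mv_vertical V p)
    = mv_cycles V K p q"
  unfolding mv_complex_anti_star mv_vertical_eq mv_cycles_def by (rule mv.kernel_sum_group)

lemma mv_cycles_subset: "mv_cycles V K p q \<subseteq> carrier (mv_complex V K (anti_star V K) p q)"
  unfolding mv_kernel[symmetric] kernel_def by blast

lemma group_mv_page1: "group (mv_page1 V K (anti_star V K) p q)"
  unfolding mv_page1_def by (rule homology_pair.group_homology_at[OF homology_pair_mv_complex])

lemma carrier_mv_page1:
  "carrier (mv_page1 V K (anti_star V K) p q) = mv_class V K p q ` mv_cycles V K p q"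
  unfolding mv_page1_def homology_pair.carrier_homology_at[OF homology_pair_mv_complex] mv_kernel
  by (intro image_cong refl mv_coset subsetD[OF mv_cycles_subset])

lemma mult_mv_page1:
  assumes "x \<in> mv_cycles V K p q" "y \<in> mv_cycles V K p q"
  shows "mv_class V K p q x \<otimes>\<^bsub>mv_page1 V K (anti_star V K) p q\<^esub> mv_class V K p q y
    = mv_class V K p q (\<lambda>S. x S + y S)"
proof -
  let ?G = "mv_complex V K (anti_star V K) p q"
  have xy: "x \<in> carrier ?G" "y \<in> carrier ?G"
    using assms by (simp_all add: subsetD[OF mv_cycles_subset])
  moreover have "x \<otimes>\<^bsub>?G\<^esub> y \<in> carrier ?G"
    using xy homology_pair.group_B[OF homology_pair_mv_complex, of p q]
    by (simp add: group.is_monoid monoid.m_closed)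
  \<comment> \<open>The product in the direct sum is cut off outside the index set and the pointwise
    sum is not, but \<open>mv_class\<close> reads only indices in the set.\<close>
  moreover have "mv_class V K p q (x \<otimes>\<^bsub>?G\<^esub> y) = mv_class V K p q (\<lambda>S. x S + y S)"
    unfolding mv_class_def mv_complex_anti_star by (intro PiE_cong) simp
  ultimately show ?thesis
    using homology_pair.mult_homology_at[OF homology_pair_mv_complex xy]
    by (simp add: mv_page1_def mv_coset)
qed

lemma group_mac_homology: "group (mac_homology V K k l)"
  using comm_group_reduced_homology[OF simplicial_complex_full_subcomplex[OF K]]
  by (simp add: mac_homology_def comm_group_def)

lemma carrier_mac_homology:
  "carrier (mac_homology V K k l) = (\<Pi>\<^sub>E I\<in>subsets_of_size V l.
    hclass (l - k - 1) (full_subcomplex K I) ` cycles (l - k - 1) (full_subcomplex K I))"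
  using comm_group_reduced_homology[OF simplicial_complex_full_subcomplex[OF K]]
  by (simp add: mac_homology_def carrier_sum_group_finite finite_subsets_of_size comm_group_def
      carrier_reduced_homology[OF simplicial_complex_full_subcomplex[OF K]])

text \<open>A product projects onto each of its factors as soon as it is nonempty, and it is
  nonempty because every class contains a chain.\<close>

lemma image_component_mv_class:
  assumes "S \<in> subsets_of_size V (p + 1)"
  shows "(\<lambda>x. x S) ` mv_class V K p q x = hclass q (full_subcomplex K (V - S)) (x S)"
proof -
  have "mv_class V K p q x \<noteq> {}"
    using hclass_nonempty unfolding mv_class_def by (auto simp: PiE_eq_empty_iff)
  then show ?thesis
    using assms unfolding mv_class_def by (simp add: image_projection_PiE)
qed

lemma page1_to_mac_class:
  assumes p: "p = int (card V) - l - 1"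
  shows "page1_to_mac V q l (mv_class V K p q x)
    = (\<lambda>I\<in>subsets_of_size V l.
        hclass q (full_subcomplex K I) (frag_cmul (reorder_sign V q (V - I)) (x (V - I))))"
  unfolding page1_to_mac_def
proof (rule restrict_ext)
  fix I assume I: "I \<in> subsets_of_size V l"
  then have "V - (V - I) = I"
    by (auto simp: subsets_of_size_def)
  moreover have "(\<lambda>x. frag_cmul (reorder_sign V q (V - I)) (x (V - I))) ` mv_class V K p q x
      = frag_cmul (reorder_sign V q (V - I)) ` (\<lambda>x. x (V - I)) ` mv_class V K p q x"
    by (simp add: image_image)
  ultimately show "(\<lambda>x. frag_cmul (reorder_sign V q (V - I)) (x (V - I))) ` mv_class V K p q x
      = hclass q (full_subcomplex K I) (frag_cmul (reorder_sign V q (V - I)) (x (V - I)))"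
    by (simp add: image_component_mv_class[OF Diff_in_subsets_of_size[OF I p]] sign_image_hclass
        reorder_sign_square)
qed

lemma page1_to_mac_iso:
  assumes p: "p = int (card V) - l - 1" and q: "q = l - k - 1"
  shows "page1_to_mac V q l \<in> iso (mv_page1 V K (anti_star V K) p q) (mac_homology V K k l)"
proof (rule isoI)
  let ?E = "mv_page1 V K (anti_star V K) p q" and ?D = "mac_homology V K k l"
  let ?e = "\<lambda>I. reorder_sign V q (V - I)"
  have Isub: "V - (V - I) = I" if "I \<in> subsets_of_size V n" for I n
    using that by (auto simp: subsets_of_size_def)
  have cyc: "frag_cmul (?e I) (x (V - I)) \<in> cycles q (full_subcomplex K I)"
    if "x \<in> mv_cycles V K p q" "I \<in> subsets_of_size V l" for x I
    using that Diff_in_subsets_of_size[OF that(2) p] Isub[OF that(2)]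
    by (auto simp: mv_cycles_def PiE_iff intro!: cycles_closed)
  show "page1_to_mac V q l \<in> hom ?E ?D"
  proof (rule homI)
    show "page1_to_mac V q l c \<in> carrier ?D" if "c \<in> carrier ?E" for c
      using that cyc by (auto simp: carrier_mv_page1 page1_to_mac_class[OF p] carrier_mac_homology
          simp flip: q)
    show "page1_to_mac V q l (c \<otimes>\<^bsub>?E\<^esub> d) = page1_to_mac V q l c \<otimes>\<^bsub>?D\<^esub> page1_to_mac V q l d"
      if "c \<in> carrier ?E" "d \<in> carrier ?E" for c d
    proof -
      from that obtain x y where xy: "x \<in> mv_cycles V K p q" "y \<in> mv_cycles V K p q"
        "c = mv_class V K p q x" "d = mv_class V K p q y"
        unfolding carrier_mv_page1 by blast
      have "frag_cmul (?e I) (x (V - I)) \<in> carrier (chain_group (full_subcomplex K I) q)"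
        "frag_cmul (?e I) (y (V - I)) \<in> carrier (chain_group (full_subcomplex K I) q)"
        if "I \<in> subsets_of_size V l" for I
        using cyc[OF xy(1) that] cyc[OF xy(2) that] by (simp_all add: cycles_iff)
      then show ?thesis
        unfolding xy(3,4) mult_mv_page1[OF xy(1,2)]
        by (auto simp: page1_to_mac_class[OF p] mac_homology_def frag_cmul_distrib2
            mult_reduced_homology[OF simplicial_complex_full_subcomplex[OF K]]
            simp flip: q intro!: restrict_ext)
    qed
  qed
  show "bij_betw (page1_to_mac V q l) (carrier ?E) (carrier ?D)"
    unfolding bij_betw_def
  proof (rule conjI[OF inj_onI equalityI[OF subsetI subsetI]])
    fix c d assume "c \<in> carrier ?E" "d \<in> carrier ?E"
      and eq: "page1_to_mac V q l c = page1_to_mac V q l d"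
    then obtain x y where xy: "c = mv_class V K p q x" "d = mv_class V K p q y"
      unfolding carrier_mv_page1 by blast
    have "hclass q (full_subcomplex K (V - S)) (x S) = hclass q (full_subcomplex K (V - S)) (y S)"
      if S: "S \<in> subsets_of_size V (p + 1)" for S
    proof -
      let ?L = "full_subcomplex K (V - S)" and ?s = "reorder_sign V q S"
      have "hclass q ?L (frag_cmul ?s (x S)) = hclass q ?L (frag_cmul ?s (y S))"
        using fun_cong[OF eq[unfolded xy page1_to_mac_class[OF p]], of "V - S"]
          Diff_in_subsets_of_size'[OF S p] Isub[OF S] by simp
      \<comment> \<open>Applying the sign a second time undoes it, as it squares to 1.\<close>
      then have "frag_cmul ?s ` hclass q ?L (frag_cmul ?s (x S)) = frag_cmul ?s ` hclass q ?L (frag_cmul ?s (y S))"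
        by simp
      then show ?thesis
        by (simp add: sign_image_hclass reorder_sign_square)
    qed
    then show "c = d"
      unfolding xy mv_class_def by (rule PiE_cong)
  next
    fix y assume "y \<in> page1_to_mac V q l ` carrier ?E"
    then show "y \<in> carrier ?D"
      using cyc by (auto simp: carrier_mv_page1 page1_to_mac_class[OF p] carrier_mac_homology
          simp flip: q)
  next
    fix y assume y: "y \<in> carrier ?D"
    then have "\<forall>I\<in>subsets_of_size V l. \<exists>z. z \<in> cycles q (full_subcomplex K I)
        \<and> y I = hclass q (full_subcomplex K I) z"
      unfolding carrier_mac_homology q[symmetric] by (auto simp: PiE_iff)
    then obtain z where z: "\<forall>I\<in>subsets_of_size V l. z I \<in> cycles q (full_subcomplex K I)
        \<and> y I = hclass q (full_subcomplex K I) (z I)"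
      by metis
    \<comment> \<open>A preimage is built from representatives \<open>z I\<close> of the components
      of \<open>y\<close>; the sign is its own inverse, so the same rescaling serves.\<close>
    define x where "x = (\<lambda>S\<in>subsets_of_size V (p + 1). frag_cmul (reorder_sign V q S) (z (V - S)))"
    have "x \<in> mv_cycles V K p q"
      using z Diff_in_subsets_of_size'[OF _ p] by (auto simp: x_def mv_cycles_def intro!: cycles_closed)
    moreover have "y = page1_to_mac V q l (mv_class V K p q x)"
    proof
      fix I
      show "y I = page1_to_mac V q l (mv_class V K p q x) I"
      proof (cases "I \<in> subsets_of_size V l")
        case True
        then show ?thesis
          using z Diff_in_subsets_of_size[OF True p] Isub[OF True]
          by (simp add: page1_to_mac_class[OF p] x_def reorder_sign_square)
      next
        case False
        then show ?thesis
          using y by (auto simp: page1_to_mac_class[OF p] carrier_mac_homology PiE_iff extensional_def)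
      qed
    qed
    ultimately show "y \<in> page1_to_mac V q l ` carrier ?E"
      unfolding carrier_mv_page1 by blast
  qed
qed

end

section \<open>The first differential and its comparison with double homology\<close>

context
  fixes V :: "'v::linorder set" and K :: "'v set set"
  assumes K: "simplicial_complex V K"
begin

lemma insert_in_subsets_of_size:
  assumes "T \<in> subsets_of_size V p" "v \<in> V - T"
  shows "insert v T \<in> subsets_of_size V (p + 1)"
proof -
  have "finite T"
    using assms finite_V[OF K] by (auto simp: subsets_of_size_def intro: finite_subset)
  then show ?thesis
    using assms by (auto simp: subsets_of_size_def)
qed

lemma full_subcomplex_insert: "full_subcomplex K (V - insert v T) \<subseteq> full_subcomplex K (V - T)"
  by (rule full_subcomplex_mono) blast

lemma mv_horizontal_carrier:
  assumes x: "x \<in> carrier (mv_complex V K (anti_star V K) p q)"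
  shows "mv_horizontal V p x \<in> carrier (mv_complex V K (anti_star V K) (p - 1) q)"
proof -
  have "x (insert v T) \<in> carrier (chain_group (full_subcomplex K (V - T)) q)"
    if "T \<in> subsets_of_size V p" "v \<in> V - T" for v T
    using x insert_in_subsets_of_size[OF that] chain_group_mono[OF full_subcomplex_insert, of v T q]
    by (auto simp: carrier_mv_complex[OF K] PiE_iff)
  then show ?thesis
    by (auto simp: carrier_mv_complex[OF K] mv_horizontal_def Let_def intro!: chain_group_closed)
qed

lemma mv_horizontal_hom:
  "mv_horizontal V p \<in> hom (mv_complex V K (anti_star V K) p q) (mv_complex V K (anti_star V K) (p - 1) q)"
proof (rule homI)
  fix x y :: "'v set \<Rightarrow> ('v set \<Rightarrow>\<^sub>0 int)"
  \<comment> \<open>The product of \<open>x\<close> and \<open>y\<close> in the direct sum. The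
    cut-off does not interfere, since \<open>insert v T\<close> always has the required
    size.\<close>
  let ?x = "\<lambda>S\<in>subsets_of_size V (p + 1). x S + y S"
  have "(\<Sum>v\<in>V - T. let S = insert v T in frag_cmul ((-1) ^ card {u \<in> S. u < v}) (?x S))
      = (\<Sum>v\<in>V - T. let S = insert v T in frag_cmul ((-1) ^ card {u \<in> S. u < v}) (x S))
        + (\<Sum>v\<in>V - T. let S = insert v T in frag_cmul ((-1) ^ card {u \<in> S. u < v}) (y S))"
    if "T \<in> subsets_of_size V p" for T
    unfolding sum.distrib[symmetric]
    by (rule sum.cong) (simp_all add: insert_in_subsets_of_size[OF that] frag_cmul_distrib2 Let_def)
  then show "mv_horizontal V p (x \<otimes>\<^bsub>mv_complex V K (anti_star V K) p q\<^esub> y)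
      = mv_horizontal V p x \<otimes>\<^bsub>mv_complex V K (anti_star V K) (p - 1) q\<^esub> mv_horizontal V p y"
    by (auto simp: mv_complex_anti_star[OF K] mv_horizontal_def intro!: restrict_ext)
qed (rule mv_horizontal_carrier)

text \<open>The squares commute without a sign: the coefficients depend only on \<open>v\<close> and
  \<open>T\<close>, and \<open>boundary\<close> is linear.\<close>

lemma mv_horizontal_vertical:
  "mv_horizontal V p (mv_vertical V p x) = mv_vertical V (p - 1) (mv_horizontal V p x)"
proof -
  have "(\<Sum>v\<in>V - T. frag_cmul ((-1) ^ card {u \<in> insert v T. u < v}) (mv_vertical V p x (insert v T)))
      = (\<Sum>v\<in>V - T. frag_cmul ((-1) ^ card {u \<in> insert v T. u < v}) (boundary (x (insert v T))))"
    if "T \<in> subsets_of_size V p" for T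
    by (rule sum.cong) (simp_all add: mv_vertical_def insert_in_subsets_of_size[OF that])
  then show ?thesis
    by (auto simp: mv_horizontal_def mv_vertical_def boundary_sum Let_def intro!: restrict_ext)
qed

lemma mv_horizontal_cycles:
  assumes x: "x \<in> mv_cycles V K p q"
  shows "mv_horizontal V p x \<in> mv_cycles V K (p - 1) q"
proof -
  have "x (insert v T) \<in> cycles q (full_subcomplex K (V - T))"
    if "T \<in> subsets_of_size V p" "v \<in> V - T" for v T
    using x insert_in_subsets_of_size[OF that] cycles_mono[OF full_subcomplex_insert, of v T q]
    by (auto simp: mv_cycles_def PiE_iff)
  then show ?thesis
    by (auto simp: mv_cycles_def mv_horizontal_def Let_def intro!: cycles_closed)
qed

lemma mv_differential1_class:
  assumes x: "x \<in> mv_cycles V K p q"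
  shows "mv_differential1 V K (anti_star V K) p q (mv_class V K p q x)
    = mv_class V K (p - 1) q (mv_horizontal V p x)"
proof -
  let ?C = "mv_complex V K (anti_star V K)"
  let ?N = "\<lambda>p. mv_vertical V p ` carrier (?C p (q + 1))"
  note pair = homology_pair_mv_complex[OF K]
  have x': "x \<in> carrier (?C p q)"
    using x mv_cycles_subset[OF K] by blast
  \<comment> \<open>The horizontal image of a vertical boundary is the vertical boundary of a
    horizontal image, so the map descends to classes.\<close>
  have "mv_horizontal V p ` ?N p \<subseteq> ?N (p - 1)"
    using mv_horizontal_carrier by (auto simp: mv_horizontal_vertical)
  then have "induced_on_classes (?C (p - 1) q) (?N (p - 1)) (mv_horizontal V p) (?N p #>\<^bsub>?C p q\<^esub> x)
      = ?N (p - 1) #>\<^bsub>?C (p - 1) q\<^esub> mv_horizontal V p x"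
    using x' by (intro induced_on_classes_coset homology_pair.group_B[OF pair]
        homology_pair.subgroup_image[OF pair] mv_horizontal_hom)
  then show ?thesis
    by (simp add: mv_differential1_def mv_coset[OF K] x' mv_horizontal_carrier)
qed

lemma mv_differential1_carrier:
  "mv_differential1 V K (anti_star V K) p q \<in> carrier (mv_page1 V K (anti_star V K) p q)
    \<rightarrow> carrier (mv_page1 V K (anti_star V K) (p - 1) q)"
  using mv_horizontal_cycles by (auto simp: carrier_mv_page1[OF K] mv_differential1_class)

text \<open>At \<open>J\<close> the horizontal differential sums over \<open>v\<close> outside
  \<open>T = V - J\<close>, that is over \<open>j\<close> in \<open>J\<close>, and its term comes
  from \<open>insert j (V - J)\<close>, the complement of \<open>J - {j}\<close>. These are the
  summands that \<open>mac_differential\<close> uses, and \<open>reorder_sign_insert\<close> matches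
  the coefficients.\<close>

lemma page1_to_mac_differential:
  assumes p: "p = int (card V) - l - 1" and q: "q = l - k - 1"
    and c: "c \<in> carrier (mv_page1 V K (anti_star V K) p q)"
  shows "page1_to_mac V q (l + 1) (mv_differential1 V K (anti_star V K) p q c)
    = mac_differential V K k l (page1_to_mac V q l c)"
proof -
  obtain x where x: "x \<in> mv_cycles V K p q" and cx: "c = mv_class V K p q x"
    using c unfolding carrier_mv_page1[OF K] by blast
  have p': "p - 1 = int (card V) - (l + 1) - 1"
    using p by simp
  let ?e = "reorder_sign V q"
  have "hclass q (full_subcomplex K J) (frag_cmul (?e (V - J)) (mv_horizontal V p x (V - J)))
      = finprod (reduced_homology q (full_subcomplex K J))
         (\<lambda>j. inclusion_induced q (full_subcomplex K J)
             (page1_to_mac V q l (mv_class V K p q x) (J - {j}))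
           [^]\<^bsub>reduced_homology q (full_subcomplex K J)\<^esub>
             ((-1) ^ nat \<bar>q + 1\<bar> * (-1) ^ card {i \<in> J - {j}. i < j} :: int)) J"
    (is "?lhs = finprod ?G ?h J")
    if J: "J \<in> subsets_of_size V (l + 1)" for J
  proof -
    let ?L = "full_subcomplex K J"
    note L = simplicial_complex_full_subcomplex[OF K]
    let ?s = "\<lambda>j. (-1) ^ nat \<bar>q + 1\<bar> * (-1) ^ card {i \<in> J - {j}. i < j} :: int"
    \<comment> \<open>The common term of both sides as a chain, written with the coefficient from
      the double homology side.\<close>
    let ?z = "\<lambda>j. frag_cmul (?s j * ?e (insert j (V - J))) (x (insert j (V - J)))"
    have JV: "J \<subseteq> V" "finite J" "V - (V - J) = J"
      using J finite_V[OF K] by (auto simp: subsets_of_size_def intro: finite_subset)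
    have T: "V - J \<in> subsets_of_size V p"
      using Diff_in_subsets_of_size[OF K J p'] by simp
    have ins: "V - (J - {j}) = insert j (V - J)" "V - insert j (V - J) = J - {j}"
      "insert j (V - J) \<in> subsets_of_size V (p + 1)" if "j \<in> J" for j
      using that JV insert_in_subsets_of_size[OF T] by auto
    have I: "J - {j} \<in> subsets_of_size V l" if "j \<in> J" for j
      using Diff_in_subsets_of_size'[OF K ins(3)[OF that] p] ins(2)[OF that] by simp
    have xj: "x (insert j (V - J)) \<in> cycles q (full_subcomplex K (J - {j}))" if "j \<in> J" for j
      using x ins[OF that] by (auto simp: mv_cycles_def PiE_iff)
    have sub: "full_subcomplex K (J - {j}) \<subseteq> ?L" for j
      by (rule full_subcomplex_mono) blast
    have xJ: "x (insert j (V - J)) \<in> cycles q ?L" if "j \<in> J" for j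
      using xj[OF that] cycles_mono[OF sub] by blast
    have h: "?h j = hclass q ?L (?z j)" if j: "j \<in> J" for j
    proof -
      let ?y = "frag_cmul (?e (insert j (V - J))) (x (insert j (V - J)))"
      have "page1_to_mac V q l (mv_class V K p q x) (J - {j}) = hclass q (full_subcomplex K (J - {j})) ?y"
        using I[OF j] ins[OF j] by (simp add: page1_to_mac_class[OF K p])
      moreover have "?y \<in> carrier (chain_group (full_subcomplex K (J - {j})) q)" "?y \<in> cycles q ?L"
        using xj[OF j] xJ[OF j] by (auto simp: cycles_iff chain_group_closed)
      ultimately show ?thesis
        using int_pow_reduced_homology[OF L[of J], of ?y q "?s j"]
        by (simp add: inclusion_induced_hclass[OF L L sub])
    qed
    have z: "?z j \<in> cycles q ?L" if "j \<in> J" for j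
      using xJ[OF that] by (rule cycles_closed)
    \<comment> \<open>The Mayer--Vietoris side. Its index set is \<open>V - (V - J) = J\<close>, and
      equality already holds for chains, before passing to classes.\<close>
    have "frag_cmul (?e (V - J)) (mv_horizontal V p x (V - J)) = (\<Sum>j\<in>J. ?z j)"
      using T JV reorder_sign_insert[OF finite_V[OF K] JV(1)]
      by (auto simp: mv_horizontal_def Let_def frag_cmul_sum intro!: sum.cong)
    then have "?lhs = finprod ?G (\<lambda>j. hclass q ?L (?z j)) J"
      by (simp only: finprod_reduced_homology[OF L JV(2) z])
    also have "\<dots> = finprod ?G ?h J"
    proof -
      interpret comm_group ?G
        by (rule comm_group_reduced_homology[OF L])
      show ?thesis
        using h hclass_in_reduced_homology[OF L z] by (intro finprod_cong') auto
    qed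
    finally show ?thesis .
  qed
  then show ?thesis
    unfolding cx mv_differential1_class[OF x] page1_to_mac_class[OF K p'] mac_differential_def
      q[symmetric] Let_def
    by (intro restrict_ext)
qed

end

section \<open>The comparison on the second page\<close>

theorem theorem3p4:
  fixes V :: "'v::linorder set" and K :: "'v set set" and m :: nat
  assumes "simplicial_complex V K" and "card V = m"
    and "no_ghost_vertices V K"
    and "K \<noteq> Pow V"
  shows "\<forall>k l :: nat.
    double_homology V K (int k) (int l)
      \<cong> mv_page2 V K (anti_star V K) (int m - int l - 1) (int l - int k - 1)"
proof (intro allI)
  fix k l :: nat
  note K = assms(1)
  define p where "p = int m - int l - 1"
  define q where "q = int l - int k - 1"
  \<comment> \<open>One equation for each of the three consecutive terms: \<open>l\<close> decreases
    as the column index increases, while the row \<open>q\<close> below stays the same.\<close>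
  have p: "p = int (card V) - int l - 1" "p + 1 = int (card V) - (int l - 1) - 1"
    "p - 1 = int (card V) - (int l + 1) - 1"
    using assms(2) by (simp_all add: p_def)
  have q: "q = int l - int k - 1" "q = (int l - 1) - (int k - 1) - 1"
    "q = (int l + 1) - (int k + 1) - 1"
    by (simp_all add: q_def)
  show "double_homology V K (int k) (int l)
      \<cong> mv_page2 V K (anti_star V K) (int m - int l - 1) (int l - int k - 1)"
    unfolding double_homology_def mv_page2_def p_def[symmetric] q_def[symmetric]
  \<comment> \<open>The comparison maps start at the first page, where projecting a coset is
    canonical, whereas the claim has double homology on the left.\<close>
  proof (rule homology_at_iso_converse)
    show "page1_to_mac V q (int l - 1) \<in> iso (mv_page1 V K (anti_star V K) (p + 1) q)
        (mac_homology V K (int k - 1) (int l - 1))"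
      by (rule page1_to_mac_iso[OF K p(2) q(2)])
    show "page1_to_mac V q (int l) \<in> iso (mv_page1 V K (anti_star V K) p q)
        (mac_homology V K (int k) (int l))"
      by (rule page1_to_mac_iso[OF K p(1) q(1)])
    show "page1_to_mac V q (int l + 1) \<in> iso (mv_page1 V K (anti_star V K) (p - 1) q)
        (mac_homology V K (int k + 1) (int l + 1))"
      by (rule page1_to_mac_iso[OF K p(3) q(3)])
    show "mv_differential1 V K (anti_star V K) (p + 1) q \<in> carrier (mv_page1 V K (anti_star V K) (p + 1) q)
        \<rightarrow> carrier (mv_page1 V K (anti_star V K) p q)"
      using mv_differential1_carrier[OF K, of "p + 1" q] by simp
    show "page1_to_mac V q (int l) (mv_differential1 V K (anti_star V K) (p + 1) q a)
        = mac_differential V K (int k - 1) (int l - 1) (page1_to_mac V q (int l - 1) a)"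
      if "a \<in> carrier (mv_page1 V K (anti_star V K) (p + 1) q)" for a
      using page1_to_mac_differential[OF K p(2) q(2) that] by simp
  qed (intro group_mv_page1[OF K] group_mac_homology[OF K] mv_differential1_carrier[OF K]
      page1_to_mac_differential[OF K p(1) q(1)]; assumption?)+
qed

end
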